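(* Every homogeneous zero-dimensional space $X$ can be represented as the quotient space of a topological group with respect to a closed subgroup; that is, there exist a topological group $G$ and a closed subgroup $H$ of $G$ such that $X$ is homeomorphic to the quotient (coset) space $G/H$.
   Context: A space $X$ is homogeneous if for all $x,y\in X$ there is a self-homeomorphism of $X$ taking $x$ to $y$. A space is zero-dimensional if it is a $T_1$-space with a base consisting of clopen (simultaneously closed and open) sets. The coset space $G/H$ carries the quotient topology. *)

theory Defs
  imports "HOL-Analysis.Analysis" "HOL-Algebra.Left_Coset"
begin

definition homogeneous_topology :: "'a topology \<Rightarrow> bool" where
  "homogeneous_topology X \<longleftrightarrow>
     (\<forall>x\<in>topspace X. \<forall>y\<in>topspace X. \<exists>f. homeomorphic_map X X f \<and> f x = y)"

text \<open>This is not the library's \<open>X dim_le 0\<close>, which does not include the T1 axiom.\<close>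

definition zero_dimensional :: "'a topology \<Rightarrow> bool" where
  "zero_dimensional X \<longleftrightarrow> t1_space X \<and>
     (\<exists>\<B>. (\<forall>U\<in>\<B>. openin X U \<and> closedin X U) \<and>
          openin X = arbitrary union_of (\<lambda>U. U \<in> \<B>))"

text \<open>The group is an HOL-Algebra record and its topology a separate object on the carrier.
  No separation axiom is assumed.\<close>

locale topological_group = group G
  for G :: "('g, 'm) monoid_scheme" (structure) and T :: "'g topology" +
  assumes topspace_eq: "topspace T = carrier G"
    and continuous_mult: "continuous_map (prod_topology T T) T (\<lambda>(x, y). x \<otimes> y)"
    and continuous_inv: "continuous_map T T (\<lambda>x. inv x)"

definition quotient_topology :: "'a topology \<Rightarrow> ('a \<Rightarrow> 'b) \<Rightarrow> 'b topology" where
  "quotient_topology T q =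
     topology (\<lambda>U. U \<subseteq> q ` topspace T \<and> openin T {x \<in> topspace T. q x \<in> U})"

lemma openin_quotient_topology:
  "openin (quotient_topology T q) U \<longleftrightarrow>
     U \<subseteq> q ` topspace T \<and> openin T {x \<in> topspace T. q x \<in> U}"
proof -
  have "istopology (\<lambda>U. U \<subseteq> q ` topspace T \<and> openin T {x \<in> topspace T. q x \<in> U})"
    unfolding istopology_def
  proof (intro conjI allI impI)
    fix S V
    assume S: "S \<subseteq> q ` topspace T \<and> openin T {x \<in> topspace T. q x \<in> S}"
      and V: "V \<subseteq> q ` topspace T \<and> openin T {x \<in> topspace T. q x \<in> V}"
    show "S \<inter> V \<subseteq> q ` topspace T" using S by blast
    have "{x \<in> topspace T. q x \<in> S \<inter> V} =
        {x \<in> topspace T. q x \<in> S} \<inter> {x \<in> topspace T. q x \<in> V}" by blast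
    then show "openin T {x \<in> topspace T. q x \<in> S \<inter> V}" using S V by auto
  next
    fix \<K>
    assume K: "\<forall>K\<in>\<K>. K \<subseteq> q ` topspace T \<and> openin T {x \<in> topspace T. q x \<in> K}"
    then show "\<Union>\<K> \<subseteq> q ` topspace T" by blast
    have "{x \<in> topspace T. q x \<in> \<Union>\<K>} = (\<Union>K\<in>\<K>. {x \<in> topspace T. q x \<in> K})" by blast
    then show "openin T {x \<in> topspace T. q x \<in> \<Union>\<K>}" using K by auto
  qed
  then show ?thesis by (simp add: quotient_topology_def)
qed

lemma topspace_quotient_topology: "topspace (quotient_topology T q) = q ` topspace T"
proof
  show "topspace (quotient_topology T q) \<subseteq> q ` topspace T"
    using openin_topspace[of "quotient_topology T q"]
    unfolding openin_quotient_topology by (rule conjunct1)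
  have "{x \<in> topspace T. q x \<in> q ` topspace T} = topspace T" by blast
  then have "openin (quotient_topology T q) (q ` topspace T)"
    by (simp add: openin_quotient_topology)
  then show "q ` topspace T \<subseteq> topspace (quotient_topology T q)"
    by (rule openin_subset)
qed

lemma quotient_map_quotient_topology: "quotient_map T (quotient_topology T q) q"
  unfolding quotient_map_def topspace_quotient_topology openin_quotient_topology by simp

definition coset_space ::
    "('g, 'm) monoid_scheme \<Rightarrow> 'g topology \<Rightarrow> 'g set \<Rightarrow> 'g set topology" where
  "coset_space G T H = quotient_topology T (\<lambda>g. g <#\<^bsub>G\<^esub> H)"

lemma (in topological_group) topspace_coset_space:
  "topspace (coset_space G T H) = lcosets H"
  by (auto simp: coset_space_def topspace_quotient_topology topspace_eq LCOSETS_def)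

end

theory Submission
  imports Defs
begin

text \<open>The group is the group of all self-homeomorphisms of \<open>X\<close>, acting on the Boolean algebra of
  clopen sets; it carries the topology of pointwise convergence for this action, the algebra being
  discrete. Thus a basic neighbourhood of \<open>g\<close> prescribes the images of finitely many clopen sets.
  A permutation action on a discrete set always makes composition and inversion continuous
  (lemma \<open>topological_group_homeo_group\<close>).

  Fix a point \<open>x\<close>. Evaluation \<open>g \<mapsto> g x\<close> is continuous because clopen sets form a base, and it is
  surjective by homogeneity. The key point is that it is open: if two points lie in the same members
  of a finite family of clopen sets, then some homeomorphism preserves every member of the
  family and moves the first point to the second (lemma \<open>exists_homeo_preserving_clopens\<close>). Here
  homogeneity gives some homeomorphism \<open>f\<close> moving one to the other; zero-dimensionality allows one to
  cut it down to a small clopen set \<open>A\<close> disjoint from \<open>f(A)\<close> and to exchange \<open>A\<close> and \<open>f(A)\<close>, leaving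
  everything else fixed. So evaluation is a quotient map whose fibres are the left cosets of the
  stabiliser of \<open>x\<close>, and the stabiliser is closed because points are.\<close>

section \<open>Clopen sets in zero-dimensional spaces\<close>

definition clopenin :: "'a topology \<Rightarrow> 'a set \<Rightarrow> bool" where
  "clopenin X U \<longleftrightarrow> openin X U \<and> closedin X U"

lemma clopenin_subset: "clopenin X U \<Longrightarrow> U \<subseteq> topspace X"
  by (simp add: clopenin_def openin_subset)

lemma clopenin_homeomorphic_image:
  assumes "homeomorphic_map X Y f" "clopenin X U"
  shows "clopenin Y (f ` U)"
  using assms homeomorphic_map_openness homeomorphic_map_closedness clopenin_subset
  unfolding clopenin_def by (metis openin_subset)

lemma zero_dimensional_clopen_nbhd:
  assumes "zero_dimensional X" "openin X U" "x \<in> U"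
  obtains A where "clopenin X A" "x \<in> A" "A \<subseteq> U"
proof -
  obtain \<B> where B: "\<forall>U\<in>\<B>. openin X U \<and> closedin X U"
    and op: "openin X = arbitrary union_of (\<lambda>U. U \<in> \<B>)"
    using assms(1) unfolding zero_dimensional_def by blast
  have "(arbitrary union_of (\<lambda>U. U \<in> \<B>)) U"
    using assms(2) op by simp
  then obtain A where "A \<in> \<B>" "x \<in> A" "A \<subseteq> U"
    unfolding arbitrary_union_of_alt using assms(3) by blast
  then show thesis
    using that B unfolding clopenin_def by blast
qed

lemma zero_dimensional_separation:
  assumes zd: "zero_dimensional X" and "x \<in> topspace X" "y \<in> topspace X" "x \<noteq> y"
  obtains A where "clopenin X A" "x \<in> A" "y \<notin> A"
proof -
  have "t1_space X"
    using zd by (simp add: zero_dimensional_def)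
  then obtain U where "openin X U" "x \<in> U" "y \<notin> U"
    using assms unfolding t1_space_def by blast
  then show thesis
    using zero_dimensional_clopen_nbhd[OF zd] that by (metis subsetD)
qed

text \<open>The points lying in the same members of a finite clopen family as a given point form an
  atom of the finite Boolean algebra generated by the family.\<close>

lemma openin_clopen_atom:
  assumes "finite \<V>" "\<forall>V\<in>\<V>. clopenin X V"
  shows "openin X {y \<in> topspace X. \<forall>V\<in>\<V>. y \<in> V \<longleftrightarrow> x \<in> V}"
  using assms
proof (induction \<V> rule: finite_induct)
  case empty
  then show ?case by simp
next
  case (insert U \<V>)
  have "openin X (if x \<in> U then U else topspace X - U)"
    using insert.prems by (auto simp: clopenin_def)
  moreover have "{y \<in> topspace X. \<forall>V\<in>insert U \<V>. y \<in> V \<longleftrightarrow> x \<in> V} =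
      {y \<in> topspace X. \<forall>V\<in>\<V>. y \<in> V \<longleftrightarrow> x \<in> V} \<inter> (if x \<in> U then U else topspace X - U)"
    by auto
  ultimately show ?case
    using insert by (metis (no_types, lifting) insertCI openin_Int)
qed

section \<open>The homeomorphism group and its action on clopen sets\<close>

text \<open>Fixing the points outside the space makes each homeomorphism have a unique representative,
  which is moreover a permutation of the whole type; group inverses are then inverse functions.\<close>

definition self_homeos :: "'a topology \<Rightarrow> ('a \<Rightarrow> 'a) set" where
  "self_homeos X = {g. homeomorphic_map X X g \<and> (\<forall>x. x \<notin> topspace X \<longrightarrow> g x = x)}"

definition homeo_group :: "'a topology \<Rightarrow> ('a \<Rightarrow> 'a) monoid" where
  "homeo_group X = \<lparr>carrier = self_homeos X, mult = (\<circ>), one = id\<rparr>"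

lemma homeo_group_simps [simp]:
  "carrier (homeo_group X) = self_homeos X"
  "g \<otimes>\<^bsub>homeo_group X\<^esub> h = g \<circ> h"
  "\<one>\<^bsub>homeo_group X\<^esub> = id"
  by (simp_all add: homeo_group_def)

lemma self_homeos_homeomorphic_map: "g \<in> self_homeos X \<Longrightarrow> homeomorphic_map X X g"
  by (simp add: self_homeos_def)

lemma self_homeos_in_topspace_iff:
  assumes "g \<in> self_homeos X"
  shows "g x \<in> topspace X \<longleftrightarrow> x \<in> topspace X"
  using assms homeomorphic_imp_surjective_map[of X X g]
  unfolding self_homeos_def by (metis (mono_tags, lifting) imageI mem_Collect_eq)

lemma self_homeos_bij:
  assumes "g \<in> self_homeos X"
  shows "bij g"
proof (rule bijI)
  have hom: "inj_on g (topspace X)" "g ` topspace X = topspace X"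
    using self_homeos_homeomorphic_map[OF assms]
    by (auto simp: homeomorphic_eq_everything_map)
  have off: "g x = x" if "x \<notin> topspace X" for x
    using assms that by (simp add: self_homeos_def)
  show "inj g"
    using hom off self_homeos_in_topspace_iff[OF assms] by (metis inj_onD injI)
  show "surj g"
    using hom off by (metis UNIV_I imageE surjI surj_def)
qed

lemma self_homeos_id: "id \<in> self_homeos X"
  by (simp add: self_homeos_def)

lemma self_homeos_comp:
  assumes "g \<in> self_homeos X" "h \<in> self_homeos X"
  shows "g \<circ> h \<in> self_homeos X"
  using assms homeomorphic_map_compose[of X X h X g] by (simp add: self_homeos_def)

lemma self_homeos_inv_into:
  assumes "g \<in> self_homeos X"
  shows "inv_into UNIV g \<in> self_homeos X"
proof -
  let ?i = "inv_into UNIV g"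
  have b: "bij g"
    by (rule self_homeos_bij[OF assms])
  obtain k where k: "homeomorphic_maps X X g k"
    using self_homeos_homeomorphic_map[OF assms] by (auto simp: homeomorphic_map_maps)
  have "k y = ?i y" if "y \<in> topspace X" for y
    using k that b by (metis bij_inv_eq_iff homeomorphic_maps_map)
  moreover have "homeomorphic_map X X k"
    using k by (simp add: homeomorphic_maps_map)
  ultimately have "homeomorphic_map X X ?i"
    by (metis homeomorphic_map_eq)
  moreover have "?i x = x" if "x \<notin> topspace X" for x
  proof -
    have "g x = x"
      using assms that by (simp add: self_homeos_def)
    then show ?thesis
      using inv_f_f[OF bij_is_inj[OF b], of x] by simp
  qed
  ultimately show ?thesis
    by (simp add: self_homeos_def)
qed

lemma group_homeo_group: "group (homeo_group X)"
proof (rule groupI)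
  fix g assume "g \<in> carrier (homeo_group X)"
  then show "\<exists>h\<in>carrier (homeo_group X). h \<otimes>\<^bsub>homeo_group X\<^esub> g = \<one>\<^bsub>homeo_group X\<^esub>"
    using self_homeos_inv_into self_homeos_bij[of g X]
    by (auto simp: bij_def intro!: bexI[of _ "inv_into UNIV g"])
qed (auto simp: self_homeos_id self_homeos_comp comp_assoc)

lemma inv_homeo_group:
  assumes "g \<in> self_homeos X"
  shows "inv\<^bsub>homeo_group X\<^esub> g = inv_into UNIV g"
proof (rule group.inv_equality[OF group_homeo_group])
  show "inv_into UNIV g \<otimes>\<^bsub>homeo_group X\<^esub> g = \<one>\<^bsub>homeo_group X\<^esub>"
    using self_homeos_bij[OF assms] by (simp add: bij_def)
qed (use assms self_homeos_inv_into in auto)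

lemma clopenin_self_homeos_image:
  "g \<in> self_homeos X \<Longrightarrow> clopenin X U \<Longrightarrow> clopenin X (g ` U)"
  using clopenin_homeomorphic_image self_homeos_homeomorphic_map by blast

section \<open>Pointwise convergence on clopen sets\<close>

definition agreement_nbhd :: "'a topology \<Rightarrow> 'a set set \<Rightarrow> ('a \<Rightarrow> 'a) \<Rightarrow> ('a \<Rightarrow> 'a) set" where
  "agreement_nbhd X \<F> g = {h \<in> self_homeos X. \<forall>U\<in>\<F>. h ` U = g ` U}"

definition clopen_topology :: "'a topology \<Rightarrow> ('a \<Rightarrow> 'a) topology" where
  "clopen_topology X = topology (\<lambda>S. S \<subseteq> self_homeos X \<and>
     (\<forall>g\<in>S. \<exists>\<F>. finite \<F> \<and> (\<forall>U\<in>\<F>. clopenin X U) \<and> agreement_nbhd X \<F> g \<subseteq> S))"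

lemma openin_clopen_topology:
  "openin (clopen_topology X) S \<longleftrightarrow> S \<subseteq> self_homeos X \<and>
     (\<forall>g\<in>S. \<exists>\<F>. finite \<F> \<and> (\<forall>U\<in>\<F>. clopenin X U) \<and> agreement_nbhd X \<F> g \<subseteq> S)"
proof -
  have "istopology (\<lambda>S. S \<subseteq> self_homeos X \<and>
     (\<forall>g\<in>S. \<exists>\<F>. finite \<F> \<and> (\<forall>U\<in>\<F>. clopenin X U) \<and> agreement_nbhd X \<F> g \<subseteq> S))"
    (is "istopology ?op")
    unfolding istopology_def
  proof (rule conjI; intro allI impI)
    fix S R assume S: "?op S" and R: "?op R"
    have "\<exists>\<F>. finite \<F> \<and> (\<forall>U\<in>\<F>. clopenin X U) \<and> agreement_nbhd X \<F> g \<subseteq> S \<inter> R"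
      if g: "g \<in> S \<inter> R" for g
    proof -
      obtain \<F> where F: "finite \<F>" "\<forall>U\<in>\<F>. clopenin X U" "agreement_nbhd X \<F> g \<subseteq> S"
        using S g by blast
      obtain \<E> where E: "finite \<E>" "\<forall>U\<in>\<E>. clopenin X U" "agreement_nbhd X \<E> g \<subseteq> R"
        using R g by blast
      have "agreement_nbhd X (\<F> \<union> \<E>) g = agreement_nbhd X \<F> g \<inter> agreement_nbhd X \<E> g"
        by (simp add: agreement_nbhd_def set_eq_iff ball_Un) blast
      then have "agreement_nbhd X (\<F> \<union> \<E>) g \<subseteq> S \<inter> R"
        using F(3) E(3) by blast
      then show ?thesis
        using F E by (intro exI[of _ "\<F> \<union> \<E>"]) auto
    qed
    then show "?op (S \<inter> R)"
      using S by blast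
  next
    fix \<K> assume K: "\<forall>K\<in>\<K>. ?op K"
    have "\<exists>\<F>. finite \<F> \<and> (\<forall>U\<in>\<F>. clopenin X U) \<and> agreement_nbhd X \<F> g \<subseteq> \<Union>\<K>"
      if "g \<in> \<Union>\<K>" for g
      using K that by (meson Union_upper UnionE order_trans)
    then show "?op (\<Union>\<K>)"
      using K by blast
  qed
  then show ?thesis
    by (simp add: clopen_topology_def)
qed

lemma topspace_clopen_topology [simp]: "topspace (clopen_topology X) = self_homeos X"
proof
  show "topspace (clopen_topology X) \<subseteq> self_homeos X"
    using openin_topspace[of "clopen_topology X"] unfolding openin_clopen_topology by blast
  have "openin (clopen_topology X) (self_homeos X)"
    unfolding openin_clopen_topology
    by (auto simp: agreement_nbhd_def intro: exI[of _ "{}"])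
  then show "self_homeos X \<subseteq> topspace (clopen_topology X)"
    by (rule openin_subset)
qed

lemma agreement_nbhd_subset: "agreement_nbhd X \<F> g \<subseteq> self_homeos X"
  by (simp add: agreement_nbhd_def)

lemma openin_agreement_nbhd:
  assumes "finite \<F>" "\<forall>U\<in>\<F>. clopenin X U"
  shows "openin (clopen_topology X) (agreement_nbhd X \<F> g)"
proof -
  have "agreement_nbhd X \<F> h = agreement_nbhd X \<F> g" if "h \<in> agreement_nbhd X \<F> g" for h
    using that by (simp add: agreement_nbhd_def)
  then show ?thesis
    unfolding openin_clopen_topology using assms agreement_nbhd_subset by blast
qed

lemma agreement_nbhd_self: "g \<in> self_homeos X \<Longrightarrow> g \<in> agreement_nbhd X \<F> g"
  by (simp add: agreement_nbhd_def)

text \<open>The image of \<open>U\<close> under \<open>g \<circ> h\<close> is determined by the image of \<open>U\<close> under \<open>h\<close> and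
  that of \<open>h ` U\<close> under \<open>g\<close>: finitely many constraints on each factor.\<close>

lemma continuous_map_comp_clopen_topology:
  "continuous_map (prod_topology (clopen_topology X) (clopen_topology X)) (clopen_topology X)
     (\<lambda>(g, h). g \<circ> h)"
  unfolding continuous_map_def
proof (intro conjI allI impI)
  show "(\<lambda>(g, h). g \<circ> h) \<in> topspace (prod_topology (clopen_topology X) (clopen_topology X))
      \<rightarrow> topspace (clopen_topology X)"
    by (auto simp: self_homeos_comp)
  fix S assume S: "openin (clopen_topology X) S"
  show "openin (prod_topology (clopen_topology X) (clopen_topology X))
     {p \<in> topspace (prod_topology (clopen_topology X) (clopen_topology X)).
       (case p of (g, h) \<Rightarrow> g \<circ> h) \<in> S}" (is "openin ?P ?S")
    unfolding openin_prod_topology_alt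
  proof (intro allI impI)
    fix g h assume "(g, h) \<in> ?S"
    then have g: "g \<in> self_homeos X" and h: "h \<in> self_homeos X" and gh: "g \<circ> h \<in> S"
      by auto
    then obtain \<F> where F: "finite \<F>" "\<forall>U\<in>\<F>. clopenin X U" "agreement_nbhd X \<F> (g \<circ> h) \<subseteq> S"
      using S unfolding openin_clopen_topology by blast
    let ?N = "agreement_nbhd X ((`) h ` \<F>) g"
    let ?M = "agreement_nbhd X \<F> h"
    have "g' \<circ> h' \<in> agreement_nbhd X \<F> (g \<circ> h)" if g': "g' \<in> ?N" and h': "h' \<in> ?M" for g' h'
    proof -
      have "(g' \<circ> h') ` U = (g \<circ> h) ` U" if "U \<in> \<F>" for U
        using g' h' that by (simp add: agreement_nbhd_def flip: image_image image_comp)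
      then show ?thesis
        using g' h' by (simp add: agreement_nbhd_def self_homeos_comp)
    qed
    then have "g' \<circ> h' \<in> S" if "g' \<in> ?N" "h' \<in> ?M" for g' h'
      using F(3) that by blast
    moreover have "?N \<subseteq> self_homeos X" "?M \<subseteq> self_homeos X"
      by (rule agreement_nbhd_subset)+
    ultimately have "?N \<times> ?M \<subseteq> ?S"
      by auto
    moreover have "openin (clopen_topology X) ?N" "openin (clopen_topology X) ?M"
      using F h clopenin_self_homeos_image by (blast intro: openin_agreement_nbhd)+
    ultimately show "\<exists>N M. openin (clopen_topology X) N \<and> openin (clopen_topology X) M \<and>
        g \<in> N \<and> h \<in> M \<and> N \<times> M \<subseteq> ?S"
      using agreement_nbhd_self[OF g] agreement_nbhd_self[OF h]
      by (intro exI[of _ ?N] exI[of _ ?M]) simp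
  qed
qed

text \<open>With \<open>V\<close> the preimage of \<open>U\<close> under \<open>g\<close>, any \<open>g'\<close> with \<open>g' ` V = g ` V = U\<close> also has \<open>V\<close> as the
  preimage of \<open>U\<close>.\<close>

lemma continuous_map_inv_clopen_topology:
  "continuous_map (clopen_topology X) (clopen_topology X) (inv_into UNIV)"
  unfolding continuous_map_def
proof (intro conjI allI impI)
  show "inv_into UNIV \<in> topspace (clopen_topology X) \<rightarrow> topspace (clopen_topology X)"
    by (auto simp: self_homeos_inv_into)
  fix S assume S: "openin (clopen_topology X) S"
  let ?S = "{g \<in> topspace (clopen_topology X). inv_into UNIV g \<in> S}"
  have "\<exists>\<E>. finite \<E> \<and> (\<forall>U\<in>\<E>. clopenin X U) \<and> agreement_nbhd X \<E> g \<subseteq> ?S" if "g \<in> ?S" for g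
  proof -
    let ?i = "inv_into UNIV g"
    have g: "g \<in> self_homeos X" and "?i \<in> S"
      using that by auto
    then obtain \<F> where F: "finite \<F>" "\<forall>U\<in>\<F>. clopenin X U" "agreement_nbhd X \<F> ?i \<subseteq> S"
      using S unfolding openin_clopen_topology by blast
    have "inv_into UNIV g' \<in> agreement_nbhd X \<F> ?i"
      if g': "g' \<in> agreement_nbhd X ((`) ?i ` \<F>) g" for g'
    proof -
      have sg': "g' \<in> self_homeos X"
        using g' by (simp add: agreement_nbhd_def)
      have "inv_into UNIV g' ` U = ?i ` U" if U: "U \<in> \<F>" for U
      proof -
        have "g' ` (?i ` U) = g ` (?i ` U)"
          using g' U by (simp add: agreement_nbhd_def)
        also have "\<dots> = U"
          by (rule image_f_inv_f[OF bij_is_surj[OF self_homeos_bij[OF g]]])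
        finally show ?thesis
          using image_inv_f_f[OF bij_is_inj[OF self_homeos_bij[OF sg']]] by metis
      qed
      then show ?thesis
        using sg' by (simp add: agreement_nbhd_def self_homeos_inv_into)
    qed
    then have "agreement_nbhd X ((`) ?i ` \<F>) g \<subseteq> ?S"
      using F(3) agreement_nbhd_subset by fastforce
    moreover have "\<forall>U\<in>(`) ?i ` \<F>. clopenin X U"
      using F(2) clopenin_self_homeos_image self_homeos_inv_into[OF g] by blast
    ultimately show ?thesis
      using F(1) by blast
  qed
  then show "openin (clopen_topology X) ?S"
    unfolding openin_clopen_topology by auto
qed

lemma topological_group_homeo_group: "topological_group (homeo_group X) (clopen_topology X)"
proof (intro topological_group.intro topological_group_axioms.intro group_homeo_group)
  show "continuous_map (clopen_topology X) (clopen_topology X) (\<lambda>g. inv\<^bsub>homeo_group X\<^esub> g)"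
    by (rule continuous_map_eq[OF continuous_map_inv_clopen_topology])
      (simp add: inv_homeo_group)
qed (use continuous_map_comp_clopen_topology in simp_all)

section \<open>Openness of evaluation\<close>

text \<open>For injective \<open>f\<close> and \<open>A\<close> disjoint from \<open>f ` A\<close>, this is the involution that exchanges the two
  sets along \<open>f\<close>.\<close>

definition swap_map :: "('a \<Rightarrow> 'a) \<Rightarrow> 'a set \<Rightarrow> 'a \<Rightarrow> 'a" where
  "swap_map f A x = (if x \<in> A then f x else if x \<in> f ` A then inv_into UNIV f x else x)"

lemma swap_map_in_self_homeos:
  assumes f: "f \<in> self_homeos X" and A: "clopenin X A" and disj: "A \<inter> f ` A = {}"
  shows "swap_map f A \<in> self_homeos X"
proof -
  let ?k = "swap_map f A"
  have inj: "inj f"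
    using self_homeos_bij[OF f] by (rule bij_is_inj)
  have AX: "A \<subseteq> topspace X"
    by (rule clopenin_subset[OF A])
  have fA: "clopenin X (f ` A)"
    by (rule clopenin_self_homeos_image[OF f A])
  have kf: "?k (f a) = a" if "a \<in> A" for a
    using that disj inj by (auto simp: swap_map_def)
  have invol: "?k (?k x) = x" for x
  proof (cases "x \<in> A \<union> f ` A")
    case True
    then show ?thesis
    proof
      assume "x \<in> A"
      then show ?thesis
        using kf by (simp add: swap_map_def)
    next
      assume "x \<in> f ` A"
      then obtain a where "a \<in> A" "x = f a"
        by blast
      then show ?thesis
        using kf by (simp add: swap_map_def)
    qed
  qed (simp add: swap_map_def)
  have off: "?k x = x" if "x \<notin> topspace X" for x
    using that AX clopenin_subset[OF fA] by (auto simp: swap_map_def)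
  have "continuous_map X X ?k"
    unfolding continuous_map_def
  proof (intro conjI allI impI)
    show "?k \<in> topspace X \<rightarrow> topspace X"
      using off invol by (metis Pi_I)
    fix U assume U: "openin X U"
    have 1: "f ` (A \<inter> U) = {x \<in> f ` A. ?k x \<in> U}"
      using kf by auto
    have 2: "A \<inter> {x \<in> topspace X. f x \<in> U} = {x \<in> A. ?k x \<in> U}"
      using AX by (auto simp: swap_map_def)
    have 3: "U - (A \<union> f ` A) = {x \<in> topspace X - (A \<union> f ` A). ?k x \<in> U}"
      using openin_subset[OF U] by (auto simp: swap_map_def)
    have "{x \<in> topspace X. ?k x \<in> U} =
        (A \<inter> {x \<in> topspace X. f x \<in> U}) \<union> f ` (A \<inter> U) \<union> (U - (A \<union> f ` A))"
      unfolding 1 2 3 using AX clopenin_subset[OF fA] by auto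
    moreover have "openin X {x \<in> topspace X. f x \<in> U}"
      using U self_homeos_homeomorphic_map[OF f] homeomorphic_imp_continuous_map
        openin_continuous_map_preimage by blast
    moreover have "openin X (f ` (A \<inter> U))"
      using U A homeomorphic_imp_open_map[OF self_homeos_homeomorphic_map[OF f]]
      by (simp add: open_map_def clopenin_def openin_Int)
    ultimately show "openin X {x \<in> topspace X. ?k x \<in> U}"
      using U A fA by (simp add: clopenin_def openin_Int openin_Un openin_diff closedin_Un)
  qed
  then have "homeomorphic_map X X ?k"
    using invol by (simp add: homeomorphic_map_involution)
  then show ?thesis
    using off by (simp add: self_homeos_def)
qed

lemma homogeneous_self_homeo:
  assumes "homogeneous_topology X" "x \<in> topspace X" "y \<in> topspace X"
  obtains f where "f \<in> self_homeos X" "f x = y"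
proof -
  obtain f where f: "homeomorphic_map X X f" "f x = y"
    using assms unfolding homogeneous_topology_def by blast
  let ?f = "\<lambda>z. if z \<in> topspace X then f z else z"
  have "homeomorphic_map X X ?f"
    by (rule homeomorphic_map_eq[OF f(1)]) simp
  then show thesis
    using that[of ?f] f(2) assms(2) by (simp add: self_homeos_def)
qed

text \<open>The exchange takes place inside the atom of the family that contains both points, and an atom
  either lies inside a member or misses it.\<close>

lemma exists_homeo_preserving_clopens:
  assumes hom: "homogeneous_topology X" and zd: "zero_dimensional X"
    and fin: "finite \<V>" and clo: "\<forall>V\<in>\<V>. clopenin X V"
    and x: "x \<in> topspace X" and y: "y \<in> topspace X" and same: "\<forall>V\<in>\<V>. y \<in> V \<longleftrightarrow> x \<in> V"
  obtains k where "k \<in> self_homeos X" "k x = y" "\<forall>V\<in>\<V>. k ` V = V"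
proof (cases "x = y")
  case True
  then show thesis
    using that[OF self_homeos_id] by simp
next
  case False
  obtain f where f: "f \<in> self_homeos X" "f x = y"
    using homogeneous_self_homeo[OF hom x y] .
  define W where "W = {z \<in> topspace X. \<forall>V\<in>\<V>. z \<in> V \<longleftrightarrow> x \<in> V}"
  obtain B where B: "clopenin X B" "x \<in> B" "y \<notin> B"
    using zero_dimensional_separation[OF zd x y False] .
  have pre: "openin X {z \<in> topspace X. f z \<in> U}" if "openin X U" for U
    using that self_homeos_homeomorphic_map[OF f(1)] homeomorphic_imp_continuous_map
      openin_continuous_map_preimage by blast
  have W: "openin X W"
    unfolding W_def by (rule openin_clopen_atom[OF fin clo])
  \<comment> \<open>\<open>B\<close> and its complement separate \<open>x\<close> from \<open>y\<close>; placing \<open>A\<close> in the first and \<open>f ` A\<close> in the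
    second makes them disjoint.\<close>
  then have "openin X (W \<inter> B \<inter> {z \<in> topspace X. f z \<in> W - B})"
    using B(1) by (intro openin_Int pre) (auto simp: clopenin_def)
  moreover have "x \<in> W \<inter> B \<inter> {z \<in> topspace X. f z \<in> W - B}"
    using x y same f B by (auto simp: W_def)
  ultimately obtain A where A: "clopenin X A" "x \<in> A"
    "A \<subseteq> W \<inter> B \<inter> {z \<in> topspace X. f z \<in> W - B}"
    by (rule zero_dimensional_clopen_nbhd[OF zd])
  let ?k = "swap_map f A"
  have disj: "A \<inter> f ` A = {}"
    using A(3) by auto
  have k: "?k \<in> self_homeos X"
    by (rule swap_map_in_self_homeos[OF f(1) A(1) disj])
  have inj: "inj f"
    using self_homeos_bij[OF f(1)] by (rule bij_is_inj)
  have kW: "?k z = z \<or> z \<in> W \<and> ?k z \<in> W" for z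
    using A(3) inj by (auto simp: swap_map_def)
  have iff: "?k z \<in> V \<longleftrightarrow> z \<in> V" if "V \<in> \<V>" for z V
    using kW[of z] that by (auto simp: W_def)
  have "?k ` V = V" if "V \<in> \<V>" for V
  proof -
    have "?k -` V = V"
      using iff[OF that] by blast
    then show ?thesis
      using surj_image_vimage_eq[OF bij_is_surj[OF self_homeos_bij[OF k]], of V] by simp
  qed
  moreover have "?k x = y"
    using A(2) f(2) by (simp add: swap_map_def)
  ultimately show thesis
    using that k by blast
qed

lemma continuous_map_evaluation:
  assumes zd: "zero_dimensional X" and x: "x \<in> topspace X"
  shows "continuous_map (clopen_topology X) X (\<lambda>g. g x)"
  unfolding continuous_map_def
proof (intro conjI allI impI)
  show "(\<lambda>g. g x) \<in> topspace (clopen_topology X) \<rightarrow> topspace X"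
    using x by (simp add: self_homeos_in_topspace_iff)
  fix U assume U: "openin X U"
  let ?S = "{g \<in> topspace (clopen_topology X). g x \<in> U}"
  have "\<exists>\<F>. finite \<F> \<and> (\<forall>U\<in>\<F>. clopenin X U) \<and> agreement_nbhd X \<F> g \<subseteq> ?S" if g: "g \<in> ?S" for g
  proof -
    have "openin X {z \<in> topspace X. g z \<in> U}"
      using U g self_homeos_homeomorphic_map[of g X] homeomorphic_imp_continuous_map
        openin_continuous_map_preimage by fastforce
    moreover have "x \<in> {z \<in> topspace X. g z \<in> U}"
      using g x by simp
    ultimately obtain A where A: "clopenin X A" "x \<in> A" "A \<subseteq> {z \<in> topspace X. g z \<in> U}"
      by (rule zero_dimensional_clopen_nbhd[OF zd])
    have "h x \<in> U" if "h \<in> agreement_nbhd X {A} g" for h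
    proof -
      have "h ` A = g ` A"
        using that by (simp add: agreement_nbhd_def)
      then obtain a where "a \<in> A" "h x = g a"
        using A(2) by (metis imageE imageI)
      then show ?thesis
        using subsetD[OF A(3), of a] by simp
    qed
    then have "agreement_nbhd X {A} g \<subseteq> ?S"
      using agreement_nbhd_subset by fastforce
    then show ?thesis
      using A(1) by (intro exI[of _ "{A}"]) simp
  qed
  then show "openin (clopen_topology X) ?S"
    unfolding openin_clopen_topology by auto
qed

text \<open>Every point in the same sets \<open>g ` U\<close> as \<open>g x\<close> is the value at \<open>x\<close> of some \<open>k \<circ> g\<close> with
  \<open>k\<close> preserving all these sets; so the image of a neighbourhood of \<open>g\<close> contains an atom.\<close>

lemma open_map_evaluation:
  assumes hom: "homogeneous_topology X" and zd: "zero_dimensional X" and x: "x \<in> topspace X"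
  shows "open_map (clopen_topology X) X (\<lambda>g. g x)"
  unfolding open_map_def
proof (intro allI impI)
  fix S assume S: "openin (clopen_topology X) S"
  have "\<exists>W. openin X W \<and> g x \<in> W \<and> W \<subseteq> (\<lambda>g. g x) ` S" if gS: "g \<in> S" for g
  proof -
    have g: "g \<in> self_homeos X"
      using S gS unfolding openin_clopen_topology by blast
    obtain \<F> where F: "finite \<F>" "\<forall>U\<in>\<F>. clopenin X U" "agreement_nbhd X \<F> g \<subseteq> S"
      using S gS unfolding openin_clopen_topology by blast
    let ?V = "(`) g ` \<F>"
    let ?W = "{y \<in> topspace X. \<forall>V\<in>?V. y \<in> V \<longleftrightarrow> g x \<in> V}"
    have V: "finite ?V" "\<forall>V\<in>?V. clopenin X V"
      using F clopenin_self_homeos_image[OF g] by auto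
    have gx: "g x \<in> topspace X"
      using g x by (simp add: self_homeos_in_topspace_iff)
    have "y \<in> (\<lambda>g. g x) ` S" if y: "y \<in> ?W" for y
    proof -
      have "y \<in> topspace X" "\<forall>V\<in>?V. y \<in> V \<longleftrightarrow> g x \<in> V"
        using y by simp_all
      then obtain k where k: "k \<in> self_homeos X" "k (g x) = y" "\<forall>V\<in>?V. k ` V = V"
        by (rule exists_homeo_preserving_clopens[OF hom zd V gx])
      have "k \<circ> g \<in> agreement_nbhd X \<F> g"
        using k(1,3) g by (simp add: agreement_nbhd_def self_homeos_comp image_comp)
      then show ?thesis
        using F(3) k(2) by (intro image_eqI[of _ _ "k \<circ> g"]) auto
    qed
    then have "?W \<subseteq> (\<lambda>g. g x) ` S"
      by (rule subsetI)
    moreover have "openin X ?W"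
      by (rule openin_clopen_atom[OF V])
    moreover have "g x \<in> ?W"
      using gx by simp
    ultimately show ?thesis
      by (intro exI[of _ ?W] conjI)
  qed
  then show "openin X ((\<lambda>g. g x) ` S)"
    by (subst openin_subopen) blast
qed

section \<open>Coset spaces of stabilisers\<close>

lemma (in group) lcoset_eq_iff:
  assumes H: "subgroup H G" and "g \<in> carrier G" "h \<in> carrier G"
  shows "g <# H = h <# H \<longleftrightarrow> inv g \<otimes> h \<in> H"
proof
  assume "g <# H = h <# H"
  then show "inv g \<otimes> h \<in> H"
    using lcos_self[OF assms(3) H] subgroup.lcos_module_imp[OF H is_group assms(2)] by simp
next
  assume "inv g \<otimes> h \<in> H"
  then have "h \<in> g <# H"
    using subgroup.lcos_module_rev[OF H is_group assms(2,3)] by simp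
  then show "g <# H = h <# H"
    using l_repr_independence[OF _ assms(2) H] by simp
qed

lemma homeomorphic_space_of_quotient_maps:
  assumes p: "quotient_map T X p" and q: "quotient_map T Y q"
    and fibres: "\<And>g h. \<lbrakk>g \<in> topspace T; h \<in> topspace T\<rbrakk> \<Longrightarrow> p g = p h \<longleftrightarrow> q g = q h"
  shows "X homeomorphic_space Y"
proof -
  obtain k where k: "continuous_map X Y k" "\<And>g. g \<in> topspace T \<Longrightarrow> k (p g) = q g"
    using quotient_map_lift_exists[OF p quotient_imp_continuous_map[OF q]] fibres by metis
  have "quotient_map T Y (k \<circ> p)"
    by (rule quotient_map_eq[OF q]) (simp add: k)
  then have "quotient_map X Y k"
    using quotient_map_compose_eq[OF p] by blast
  moreover have "inj_on k (topspace X)"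
    using k(2) fibres unfolding quotient_imp_surjective_map[OF p, symmetric] inj_on_def by auto
  ultimately have "homeomorphic_map X Y k"
    by (simp add: homeomorphic_map_def)
  then show ?thesis
    by (rule homeomorphic_map_imp_homeomorphic_space)
qed

theorem theorem4p8:
  fixes X :: "'a topology"
  assumes "topspace X \<noteq> {}"
    and "homogeneous_topology X"
    and "zero_dimensional X"
  shows "\<exists>(G :: ('a \<Rightarrow> 'a) monoid) T H.
           topological_group G T \<and> subgroup H G \<and> closedin T H \<and>
           X homeomorphic_space coset_space G T H"
proof -
  obtain x where x: "x \<in> topspace X"
    using assms(1) by blast
  let ?G = "homeo_group X"
  let ?T = "clopen_topology X"
  let ?H = "{g \<in> self_homeos X. g x = x}"
  interpret group ?G
    by (rule group_homeo_group)
  have inv_at: "inv_into UNIV g y = z \<longleftrightarrow> g z = y" if "g \<in> self_homeos X" for g y z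
    using self_homeos_bij[OF that] by (metis bij_inv_eq_iff)
  have sub: "subgroup ?H ?G"
    by (rule subgroupI)
      (auto simp: inv_homeo_group self_homeos_inv_into self_homeos_comp inv_at self_homeos_id
        intro!: exI[of _ id])
  have cont: "continuous_map ?T X (\<lambda>g. g x)"
    by (rule continuous_map_evaluation[OF assms(3) x])
  have "closedin X {x}"
    using assms(3) x by (simp add: zero_dimensional_def t1_space_closedin_singleton)
  then have "closedin ?T {g \<in> topspace ?T. g x \<in> {x}}"
    by (rule closedin_continuous_map_preimage[OF cont])
  then have closed: "closedin ?T ?H"
    by simp
  have "(\<lambda>g. g x) ` topspace ?T = topspace X"
  proof
    show "topspace X \<subseteq> (\<lambda>g. g x) ` topspace ?T"
    proof
      fix y assume "y \<in> topspace X"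
      then obtain g where "g \<in> self_homeos X" "g x = y"
        using homogeneous_self_homeo[OF assms(2) x] by metis
      then show "y \<in> (\<lambda>g. g x) ` topspace ?T"
        by (intro image_eqI[of _ _ g]) simp_all
    qed
  qed (use x in \<open>auto simp: self_homeos_in_topspace_iff\<close>)
  then have ev: "quotient_map ?T X (\<lambda>g. g x)"
    by (rule continuous_open_imp_quotient_map[OF cont open_map_evaluation[OF assms(2,3) x]])
  have "g x = h x \<longleftrightarrow> g <#\<^bsub>?G\<^esub> ?H = h <#\<^bsub>?G\<^esub> ?H"
    if "g \<in> topspace ?T" "h \<in> topspace ?T" for g h
    using that lcoset_eq_iff[OF sub, of g h] inv_at[of g "h x" x]
    by (simp add: inv_homeo_group self_homeos_comp self_homeos_inv_into)
  then have "X homeomorphic_space coset_space ?G ?T ?H"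
    unfolding coset_space_def
    by (rule homeomorphic_space_of_quotient_maps[OF ev quotient_map_quotient_topology])
  then show ?thesis
    using topological_group_homeo_group sub closed by blast
qed

end
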